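(* Let $\mathcal{C}$ be a uniform clutter with vertex set $\{x_1,\ldots,x_n\}$, let $A$ be its incidence matrix, and let $v_1,\ldots,v_q$ be the columns of $A$. Let $K$ be a field, $R=K[x_1,\ldots,x_n]$ a polynomial ring and $t$ a new variable. If either the system $x\geq 0;\ xA\leq\mathbf{1}$ or the system $x\geq 0;\ xA\geq\mathbf{1}$ has the integer rounding property and $P=\mathrm{conv}(v_1,\ldots,v_q)$, then $$K[x^{v_1}t,\ldots,x^{v_q}t]=A(P)$$ as subrings of $R[t]$, where $A(P)$ is the Ehrhart ring of $P$.
   Context: A clutter $\mathcal{C}$ with finite vertex set $X=\{x_1,\ldots,x_n\}$ is a family of subsets of $X$, called edges, none of which is included in another. It is assumed that $\mathcal{C}$ has no isolated vertices, i.e., each vertex occurs in at least one edge. $\mathcal{C}$ is uniform if all its edges have the same number of elements. If $f_1,\ldots,f_q$ are the edges, the characteristic vector of $f_k$ is $v_k=\sum_{x_i\in f_k}e_i$, where $e_i$ is the $i$-th unit vector in $\mathbb{R}^n$, and the incidence matrix $A$ is the $n\times q$ matrix with columns $v_1,\ldots,v_q$. Inequalities between vectors are entrywise, $\mathbf{1}$ is the vector with all entries equal to $1$, $\langle\ ,\ \rangle$ is the standard inner product, $\mathbb{N}=\{0,1,2,\ldots\}$, and $\mathrm{conv}$ denotes convex hull. For $a\in\mathbb{N}^n$, $x^a=x_1^{a_1}\cdots x_n^{a_n}$. The system $x\geq 0;\ xA\leq\mathbf{1}$ has the integer rounding property if $$\lceil\min\{\langle y,\mathbf{1}\rangle \mid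 y\geq 0;\ Ay\geq \alpha\}\rceil=\min\{\langle y,\mathbf{1}\rangle \mid Ay\geq \alpha;\ y\in\mathbb{N}^q\}$$ for each integral vector $\alpha\in\mathbb{Z}^n$ for which $\min\{\langle y,\mathbf{1}\rangle \mid y\geq 0;\ Ay\geq \alpha\}$ is finite. The system $x\geq 0;\ xA\geq\mathbf{1}$ has the integer rounding property if $$\max\{\langle y,\mathbf{1}\rangle \mid Ay\leq w;\ y\in\mathbb{N}^q\}=\lfloor\max\{\langle y,\mathbf{1}\rangle \mid y\geq 0;\ Ay\leq w\}\rfloor$$ for each integral vector $w\in\mathbb{Z}^n$ for which the right-hand side is finite. (In the maxima and minima without the condition $y\in\mathbb{N}^q$, $y$ ranges over $\mathbb{R}^q$.) The Ehrhart ring of the lattice polytope $P$ is the monomial subring $$A(P)=K[\{x^at^i\mid a\in\mathbb{Z}^n\cap iP;\ i\in\mathbb{N}\}]\subset R[t].$$ *)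

theory Defs
  imports "HOL-Analysis.Analysis" "HOL-Library.Poly_Mapping" "HOL-Computational_Algebra.Polynomial"
begin

text \<open>The vertices are the elements of a finite type, so the vertex set is \<open>UNIV\<close>; the last
  conjunct says that there are no isolated vertices.\<close>

definition clutter :: "'n::finite set set \<Rightarrow> bool" where
  "clutter C \<longleftrightarrow> (\<forall>e\<in>C. \<forall>e'\<in>C. e \<subseteq> e' \<longrightarrow> e = e') \<and> (\<forall>x. \<exists>e\<in>C. x \<in> e)"

definition uniform :: "'n::finite set set \<Rightarrow> bool" where
  "uniform C \<longleftrightarrow> (\<exists>d. \<forall>e\<in>C. card e = d)"

definition characteristic_vector :: "'n::finite set \<Rightarrow> real^'n" where
  "characteristic_vector e = (\<Sum>i\<in>e. axis i 1)"

definition incidence_matrix :: "('q::finite \<Rightarrow> 'n::finite set) \<Rightarrow> real^'q^'n" where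
  "incidence_matrix f = (\<chi> i k. characteristic_vector (f k) $ i)"

definition is_min :: "real set \<Rightarrow> real \<Rightarrow> bool" where
  "is_min S m \<longleftrightarrow> m \<in> S \<and> (\<forall>s\<in>S. m \<le> s)"

definition is_max :: "real set \<Rightarrow> real \<Rightarrow> bool" where
  "is_max S m \<longleftrightarrow> m \<in> S \<and> (\<forall>s\<in>S. s \<le> m)"

definition integral_vec :: "real^'n::finite \<Rightarrow> bool" where
  "integral_vec a \<longleftrightarrow> (\<forall>i. a $ i \<in> \<int>)"

definition natural_vec :: "real^'n::finite \<Rightarrow> bool" where
  "natural_vec a \<longleftrightarrow> (\<forall>i. a $ i \<in> \<nat>)"

text \<open>Integer rounding for the systems \<open>x \<ge> 0; xA \<le> 1\<close> and \<open>x \<ge> 0; xA \<ge> 1\<close>.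
  Here \<open>\<le>\<close> on vectors is entrywise and \<open>1\<close> is the all-ones vector.
  A minimum or maximum is finite if it exists: a feasible linear program with bounded objective
  attains its optimum.  The conclusion includes the existence of the integral optimum.\<close>

definition integer_rounding_le :: "real^'q::finite^'n::finite \<Rightarrow> bool" where
  "integer_rounding_le A \<longleftrightarrow>
    (\<forall>\<alpha> m. integral_vec \<alpha> \<longrightarrow>
      is_min {y \<bullet> 1 | y. 0 \<le> y \<and> \<alpha> \<le> A *v y} m \<longrightarrow>
      is_min {y \<bullet> 1 | y. \<alpha> \<le> A *v y \<and> natural_vec y} (of_int \<lceil>m\<rceil>))"

definition integer_rounding_ge :: "real^'q::finite^'n::finite \<Rightarrow> bool" where
  "integer_rounding_ge A \<longleftrightarrow>
    (\<forall>w m. integral_vec w \<longrightarrow>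
      is_max {y \<bullet> 1 | y. 0 \<le> y \<and> A *v y \<le> w} m \<longrightarrow>
      is_max {y \<bullet> 1 | y. A *v y \<le> w \<and> natural_vec y} (of_int \<lfloor>m\<rfloor>))"

text \<open>\<open>R = K[x\<^sub>1,\<dots>,x\<^sub>n]\<close>, with the variables indexed by \<open>'n\<close>, and \<open>R[t]\<close>.\<close>

type_synonym ('n, 'k) R = "('n \<Rightarrow>\<^sub>0 nat) \<Rightarrow>\<^sub>0 'k"
type_synonym ('n, 'k) Rt = "('n, 'k) R poly"

definition var :: "'n \<Rightarrow> ('n, 'k::field) R" where
  "var i = Poly_Mapping.single (Poly_Mapping.single i 1) 1"

text \<open>\<open>x\<^sup>a\<close> for a vector \<open>a\<close> with entries in \<open>\<nat>\<close>.  Exponents are real vectors so that columns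
  of \<open>A\<close> and points of polytopes can be used directly; \<open>nat \<lfloor>_\<rfloor>\<close> only converts the type, and
  the value is not meaningful for other vectors.\<close>

definition xpow :: "real^'n::finite \<Rightarrow> ('n, 'k::field) R" where
  "xpow a = (\<Prod>i\<in>UNIV. var i ^ nat \<lfloor>a $ i\<rfloor>)"

definition const :: "'k::field \<Rightarrow> ('n, 'k) Rt" where
  "const c = [:Poly_Mapping.single 0 c:]"

definition subalgebra :: "('n, 'k::field) Rt set \<Rightarrow> bool" where
  "subalgebra S \<longleftrightarrow> range const \<subseteq> S \<and> (\<forall>p\<in>S. \<forall>q\<in>S. p + q \<in> S \<and> p - q \<in> S \<and> p * q \<in> S)"

definition adjoin :: "('n, 'k::field) Rt set \<Rightarrow> ('n, 'k) Rt set" where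
  "adjoin F = subalgebra hull F"

text \<open>\<open>P\<close> is meant to lie in the nonnegative orthant, so that the lattice points of \<open>iP\<close> are
  exponents of monomials of \<open>R\<close>; \<open>monom (xpow a) i\<close> is \<open>x\<^sup>a t\<^sup>i\<close>.\<close>

definition ehrhart_ring :: "(real^'n::finite) set \<Rightarrow> ('n, 'k::field) Rt set" where
  "ehrhart_ring P =
    adjoin {monom (xpow a) i | a i. integral_vec a \<and> a \<in> (\<lambda>p. real i *\<^sub>R p) ` P}"

end

(* If every edge has d elements, summing the entries of A y gives d <y,1>.  Hence a lattice point
   a = A y of iP is a vector for which both linear programs have optimum exactly i; integer rounding
   returns an integral optimum z with <z,1> = i and A z comparable with a, and since both vectors
   have entry sum d i they are equal.  So x^a t^i is a monomial in the x^(v_k) t. *)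
theory Submission
  imports Defs
begin

section \<open>Subalgebras\<close>

lemma const_1: "const 1 = 1"
  by (simp add: const_def one_pCons)

text \<open>\<open>adjoin F\<close> is an intersection of subalgebras, and each closure condition in
  \<open>subalgebra\<close> survives intersection.\<close>

lemma subalgebra_adjoin: "subalgebra (adjoin F)"
  unfolding adjoin_def by (rule hull_in) (auto simp: subalgebra_def)

lemma subset_adjoin: "F \<subseteq> adjoin F"
  unfolding adjoin_def by (rule hull_subset)

lemma adjoin_subset_adjoin:
  assumes "F \<subseteq> adjoin G"
  shows "adjoin F \<subseteq> adjoin G"
  using hull_minimal[of F "adjoin G" subalgebra] assms subalgebra_adjoin by (auto simp: adjoin_def)

lemma subalgebra_one: "subalgebra S \<Longrightarrow> 1 \<in> S"
  unfolding subalgebra_def by (metis const_1 rangeI subsetD)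

lemma subalgebra_mult: "subalgebra S \<Longrightarrow> p \<in> S \<Longrightarrow> q \<in> S \<Longrightarrow> p * q \<in> S"
  by (simp add: subalgebra_def)

lemma subalgebra_power: "subalgebra S \<Longrightarrow> p \<in> S \<Longrightarrow> p ^ n \<in> S"
  by (induction n) (auto intro: subalgebra_one subalgebra_mult)

lemma subalgebra_prod:
  assumes "subalgebra S" "\<And>k. k \<in> I \<Longrightarrow> g k \<in> S"
  shows "prod g I \<in> S"
  using assms(2)
  by (induction I rule: infinite_finite_induct) (auto intro: subalgebra_one subalgebra_mult assms(1))

section \<open>Monomials\<close>

lemma monom_prod: "(\<Prod>k\<in>I. monom (g k) (m k)) = monom (prod g I) (sum m I)"
  \<comment> \<open>An infinite \<open>I\<close> is harmless: both products default to 1 and the sum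
    to 0, and \<open>monom 1 0\<close> is 1.\<close>
  by (induction I rule: infinite_finite_induct) (auto simp: mult_monom monom_eq_1)

text \<open>Exponents add only where the floor and \<open>nat\<close> in \<open>xpow\<close> lose
  nothing; natural entries guarantee this for each \<open>v k\<close> and for the
  combination.\<close>

lemma xpow_sum:
  fixes v :: "'q::finite \<Rightarrow> real^'n::finite" and c :: "'q \<Rightarrow> nat"
  assumes "\<And>k. natural_vec (v k)"
  shows "xpow (\<Sum>k\<in>UNIV. real (c k) *\<^sub>R v k) = (\<Prod>k\<in>UNIV. xpow (v k) ^ c k)"
proof -
  define e where "e k i = nat \<lfloor>v k $ i\<rfloor>" for k i
  have e: "v k $ i = real (e k i)" for k i
    using assms[of k] by (auto simp: natural_vec_def e_def elim!: Nats_cases dest: spec[of _ i])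
  have "(\<Sum>k\<in>UNIV. real (c k) *\<^sub>R v k) $ i = real (\<Sum>k\<in>UNIV. e k i * c k)" for i
    by (simp add: e mult.commute)
  then have "nat \<lfloor>(\<Sum>k\<in>UNIV. real (c k) *\<^sub>R v k) $ i\<rfloor> = (\<Sum>k\<in>UNIV. e k i * c k)" for i
    by (metis floor_of_nat nat_int)
  then have "xpow (\<Sum>k\<in>UNIV. real (c k) *\<^sub>R v k) = (\<Prod>i\<in>UNIV. \<Prod>k\<in>UNIV. (var i ^ e k i) ^ c k)"
    by (simp add: xpow_def power_sum power_mult)
  also have "\<dots> = (\<Prod>k\<in>UNIV. xpow (v k) ^ c k)"
    \<comment> \<open>Swapping the products over variables and over indices \<open>k\<close>
      collects, for each \<open>k\<close>, the factors of \<open>xpow (v k) ^ c k\<close>.\<close>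
    by (subst prod.swap) (simp add: xpow_def e_def prod_power_distrib)
  finally show ?thesis .
qed

text \<open>The monomial is the product of the generators raised to the powers \<open>c k\<close>.
  Each generator has degree 1 in t, so the t-degree counts the factors.\<close>

lemma monom_xpow_sum_in_adjoin:
  fixes v :: "'q::finite \<Rightarrow> real^'n::finite" and c :: "'q \<Rightarrow> nat"
  assumes "\<And>k. natural_vec (v k)"
  shows "monom (xpow (\<Sum>k\<in>UNIV. real (c k) *\<^sub>R v k)) (\<Sum>k\<in>UNIV. c k)
    \<in> (adjoin {monom (xpow (v k)) 1 | k. True} :: ('n, 'k::field) Rt set)" (is "_ \<in> ?S")
proof -
  have "(\<Prod>k\<in>UNIV. monom (xpow (v k)) 1 ^ c k) \<in> ?S"
    by (intro subalgebra_prod subalgebra_power subalgebra_adjoin subset_adjoin[THEN subsetD]) blast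
  then show ?thesis
    by (simp add: xpow_sum assms monom_prod monom_power)
qed

section \<open>Incidence matrices of uniform clutters\<close>

lemma characteristic_vector_nth: "characteristic_vector e $ i = (if i \<in> e then 1 else 0)"
  by (simp add: characteristic_vector_def axis_def)

lemma column_incidence_matrix: "column k (incidence_matrix f) = characteristic_vector (f k)"
  by (simp add: column_def incidence_matrix_def vec_eq_iff)

lemma inner_one: "(y::real^'q::finite) \<bullet> 1 = (\<Sum>k\<in>UNIV. y $ k)"
  by (simp add: inner_vec_def)

lemma matrix_vector_mult_columns:
  fixes A :: "real^'q::finite^'n::finite"
  shows "A *v y = (\<Sum>k\<in>UNIV. y $ k *\<^sub>R column k A)"
  by (simp add: matrix_mult_sum scalar_mult_eq_scaleR)

text \<open>Uniformity enters here: every column has entry sum \<open>d\<close>, and the rest is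
  linearity.\<close>

lemma incidence_matrix_inner_one:
  fixes f :: "'q::finite \<Rightarrow> 'n::finite set"
  assumes "\<And>k. card (f k) = d"
  shows "(incidence_matrix f *v y) \<bullet> 1 = real d * (y \<bullet> 1)"
proof -
  have "characteristic_vector (f k) \<bullet> 1 = real d" for k
    by (simp add: inner_one characteristic_vector_nth assms sum.If_cases)
  then show ?thesis
    by (simp add: matrix_vector_mult_columns column_incidence_matrix inner_sum_left inner_one[of y]
        sum_distrib_left mult.commute)
qed

lemma inner_one_mono: "(a::real^'n::finite) \<le> b \<Longrightarrow> a \<bullet> 1 \<le> b \<bullet> 1"
  by (simp add: inner_one less_eq_vec_def sum_mono)

text \<open>The entries of \<open>b - a\<close> are nonnegative with sum zero, so all of them
  vanish.\<close>

lemma vec_eq_if_le_inner_one: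
  fixes a b :: "real^'n::finite"
  assumes "a \<le> b" "a \<bullet> 1 = b \<bullet> 1"
  shows "a = b"
proof -
  have "(\<Sum>i\<in>UNIV. b $ i - a $ i) = 0"
    using assms(2) by (simp add: inner_one sum_subtractf)
  moreover have "\<And>i. 0 \<le> b $ i - a $ i"
    using assms(1) by (simp add: less_eq_vec_def)
  ultimately have "\<forall>i. b $ i - a $ i = 0"
    by (subst (asm) sum_nonneg_eq_0_iff) auto
  then show ?thesis
    by (simp add: vec_eq_iff)
qed

lemma integral_decomposition:
  fixes f :: "'q::finite \<Rightarrow> 'n::finite set"
  assumes d: "\<And>k. card (f k) = d" "d > 0"
    and rounding: "integer_rounding_le (incidence_matrix f) \<or> integer_rounding_ge (incidence_matrix f)"
    and y: "0 \<le> y" "y \<bullet> 1 = real i" "integral_vec (incidence_matrix f *v y)"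
  obtains z where "natural_vec z" "z \<bullet> 1 = real i" "incidence_matrix f *v z = incidence_matrix f *v y"
proof -
  let ?A = "incidence_matrix f"
  \<comment> \<open>Both sides are compared after multiplication by \<open>d\<close>, which cancels
    because \<open>d > 0\<close>.\<close>
  have le: "y' \<bullet> 1 \<le> y'' \<bullet> 1" if "?A *v y' \<le> ?A *v y''" for y' y''
    using inner_one_mono[OF that] d by (simp add: incidence_matrix_inner_one)
  have eq: "?A *v y' = ?A *v y''" if "?A *v y' \<le> ?A *v y''" "y' \<bullet> 1 = y'' \<bullet> 1" for y' y''
    using that by (intro vec_eq_if_le_inner_one) (simp_all add: incidence_matrix_inner_one d(1))
  from rounding show ?thesis
  proof
    assume "integer_rounding_le ?A"
    \<comment> \<open>\<open>y\<close> is feasible with value \<open>i\<close>, and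
      \<open>le\<close> shows that no feasible point has a smaller value. As \<open>i\<close> is an
      integer, the ceiling leaves it unchanged.\<close>
    moreover have "is_min {y' \<bullet> 1 | y'. 0 \<le> y' \<and> ?A *v y \<le> ?A *v y'} (real i)"
      unfolding is_min_def using y(1,2) le by (fastforce intro: exI[of _ y])
    ultimately have "is_min {z \<bullet> 1 | z. ?A *v y \<le> ?A *v z \<and> natural_vec z} (of_int \<lceil>real i\<rceil>)"
      using y(3) unfolding integer_rounding_le_def by blast
    then obtain z where "?A *v y \<le> ?A *v z" "natural_vec z" "z \<bullet> 1 = real i"
      unfolding is_min_def by auto
    then show ?thesis
      using that eq[of y z] y(2) by simp
  next
    assume "integer_rounding_ge ?A"
    \<comment> \<open>With the inequality reversed, \<open>le\<close> bounds every feasible value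
      above by \<open>i\<close>, and \<open>y\<close> attains this bound.\<close>
    moreover have "is_max {y' \<bullet> 1 | y'. 0 \<le> y' \<and> ?A *v y' \<le> ?A *v y} (real i)"
      unfolding is_max_def using y(1,2) le by (fastforce intro: exI[of _ y])
    ultimately have "is_max {z \<bullet> 1 | z. ?A *v z \<le> ?A *v y \<and> natural_vec z} (of_int \<lfloor>real i\<rfloor>)"
      using y(3) unfolding integer_rounding_ge_def by blast
    then obtain z where "?A *v z \<le> ?A *v y" "natural_vec z" "z \<bullet> 1 = real i"
      unfolding is_max_def by auto
    then show ?thesis
      using that eq[of z y] y(2) by simp
  qed
qed

text \<open>The linear image of the standard simplex is convex and contains each column as the image
  of a unit vector; hence it contains the hull.\<close>

lemma convex_hull_columnsE:
  fixes A :: "real^'q::finite^'n::finite"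
  assumes "p \<in> convex hull (range (\<lambda>k. column k A))"
  obtains y where "0 \<le> y" "y \<bullet> 1 = 1" "p = A *v y"
proof -
  let ?T = "{A *v y | y. 0 \<le> y \<and> y \<bullet> 1 = 1}"
  have "convex {y::real^'q. 0 \<le> y \<and> y \<bullet> 1 = 1}"
    by (auto simp: convex_def inner_left_distrib less_eq_vec_def)
  then have "convex ((*v) A ` {y. 0 \<le> y \<and> y \<bullet> 1 = 1})"
    by (rule convex_linear_image[rotated]) simp
  then have "convex ?T"
    by (simp add: setcompr_eq_image)
  moreover have "column k A \<in> ?T" for k
  proof -
    have "0 \<le> axis k (1::real)" "axis k (1::real) \<bullet> 1 = 1"
      by (simp_all add: less_eq_vec_def inner_axis') (simp add: axis_def)
    then show ?thesis
      by (auto intro!: exI[of _ "axis k 1"] simp: matrix_vector_mult_basis)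
  qed
  ultimately have "convex hull (range (\<lambda>k. column k A)) \<subseteq> ?T"
    by (intro hull_minimal) auto
  then show thesis
    using assms that by blast
qed

theorem corollary2p4:
  fixes C :: "'n::finite set set"
    and f :: "'q::finite \<Rightarrow> 'n set"
    and A :: "real^'q^'n"
    and v :: "'q \<Rightarrow> real^'n"
    and P :: "(real^'n) set"
  assumes "clutter C" and "uniform C"
    and "bij_betw f UNIV C"
    and "A = incidence_matrix f"
    and "v = (\<lambda>k. column k A)"
    and "integer_rounding_le A \<or> integer_rounding_ge A"
    and "P = convex hull (range v)"
  shows "adjoin {monom (xpow (v k)) 1 | k. True} = (ehrhart_ring P :: ('n, 'k::field) Rt set)"
proof
  have f: "range f = C"
    using assms(3) by (simp add: bij_betw_def)
  obtain d where d: "card (f k) = d" for k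
    using assms(2) f unfolding uniform_def by blast
  \<comment> \<open>Some vertex exists because types are nonempty, and it lies in an edge because
    none is isolated. That edge is nonempty, so \<open>d > 0\<close>.\<close>
  obtain e x where "x \<in> e" "e \<in> C"
    using assms(1) unfolding clutter_def by blast
  then have "d > 0"
    using d f by (metis card_gt_0_iff empty_iff finite imageE)
  have v: "v k = characteristic_vector (f k)" for k
    by (simp add: assms(4,5) column_incidence_matrix)
  have natural: "natural_vec (v k)" for k
    by (simp add: v natural_vec_def characteristic_vector_nth)
  have integral: "integral_vec (v k)" for k
    by (simp add: v integral_vec_def characteristic_vector_nth)

  \<comment> \<open>Each generator \<open>monom (xpow (v k)) 1\<close> is the Ehrhart generator of
    the lattice point \<open>v k\<close> at dilation factor 1.\<close>
  have "v k \<in> (\<lambda>p. real 1 *\<^sub>R p) ` P" for k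
    by (simp add: assms(7) hull_inc)
  then have "{monom (xpow (v k)) 1 | k. True} \<subseteq>
      {monom (xpow a) i :: ('n, 'k) Rt | a i. integral_vec a \<and> a \<in> (\<lambda>p. real i *\<^sub>R p) ` P}"
    using integral by blast
  then show "adjoin {monom (xpow (v k)) 1 | k. True} \<subseteq> (ehrhart_ring P :: ('n, 'k) Rt set)"
    unfolding ehrhart_ring_def by (meson adjoin_subset_adjoin order_trans subset_adjoin)

  have "monom (xpow a) i \<in> (adjoin {monom (xpow (v k)) 1 | k. True} :: ('n, 'k) Rt set)"
    if a: "integral_vec a" "a \<in> (\<lambda>p. real i *\<^sub>R p) ` P" for a i
  proof -
    obtain p where p: "p \<in> P" "a = real i *\<^sub>R p"
      using a(2) by blast
    obtain y where y: "0 \<le> y" "y \<bullet> 1 = 1" "p = A *v y"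
      using p(1) convex_hull_columnsE unfolding assms(5,7) by blast
    \<comment> \<open>Scaling the convex coefficients of \<open>p\<close> by \<open>i\<close> gives
      nonnegative coefficients of \<open>a\<close> with sum \<open>i\<close>; the case
      \<open>i = 0\<close> is included.\<close>
    have a_eq: "a = A *v (real i *\<^sub>R y)"
      by (simp add: p y matrix_vector_mult_scaleR)
    have "0 \<le> real i *\<^sub>R y" "(real i *\<^sub>R y) \<bullet> 1 = real i"
      using y by (simp_all add: less_eq_vec_def)
    then obtain z where z: "natural_vec z" "z \<bullet> 1 = real i" "A *v z = a"
      using integral_decomposition[OF d \<open>d > 0\<close> assms(6)[unfolded assms(4)]] a(1)
      unfolding assms(4) a_eq by blast
    have "\<forall>k. \<exists>m. z $ k = real m"
      using z(1) unfolding natural_vec_def by (meson Nats_cases)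
    then obtain c where c: "\<And>k. z $ k = real (c k)"
      by (auto dest: choice)
    \<comment> \<open>The entry sum of \<open>z\<close> is the t-degree of the product of
      generators, so that degree is exactly \<open>i\<close>.\<close>
    have "real (\<Sum>k\<in>UNIV. c k) = real i"
      using z(2) by (simp add: inner_one c)
    then have "(\<Sum>k\<in>UNIV. c k) = i"
      by (simp only: of_nat_eq_iff)
    moreover have "a = (\<Sum>k\<in>UNIV. real (c k) *\<^sub>R v k)"
      by (simp add: assms(5) c matrix_vector_mult_columns flip: z(3))
    ultimately show ?thesis
      using monom_xpow_sum_in_adjoin[of v c] natural by simp
  qed
  then show "(ehrhart_ring P :: ('n, 'k) Rt set) \<subseteq> adjoin {monom (xpow (v k)) 1 | k. True}"
    unfolding ehrhart_ring_def by (intro adjoin_subset_adjoin) blast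
qed

end
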